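(* Let $\mathbf L=(L,\vee,\wedge,0,1)$ be a bounded lattice, $a,b\in L$ with $a\leq b$, $x\in[a,b]$, let $y$ be a complement of $x$ (i.e. $x\vee y=1$, $x\wedge y=0$), and put $e:=(a\vee y)\wedge b$ and $f:=a\vee(y\wedge b)$. Then $f\leq e$, and the following are equivalent: (i) $e,f\in R(a,b,x)$; (ii) $(a,y,x)$ and $(x,y,b)$ are modular triples.
   Context: For a lattice and elements $a\leq b$, $x\in[a,b]$, an element $z\in[a,b]$ is a relative complement of $x$ in $[a,b]$ if $x\vee z=b$ and $x\wedge z=a$; $R(a,b,x)$ denotes the set of all such relative complements. A triple $(p,q,r)$ of elements of a lattice is called modular if $p\leq r$ and $(p\vee q)\wedge r=p\vee(q\wedge r)$. *)

theory Defs
  imports Main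
begin

unbundle lattice_syntax

definition complement_of :: "'a::bounded_lattice \<Rightarrow> 'a \<Rightarrow> bool" where
  "complement_of x y \<longleftrightarrow> x \<squnion> y = \<top> \<and> x \<sqinter> y = \<bottom>"

definition relative_complements :: "'a::lattice \<Rightarrow> 'a \<Rightarrow> 'a \<Rightarrow> 'a set" where
  "relative_complements a b x = {z \<in> {a..b}. x \<squnion> z = b \<and> x \<sqinter> z = a}"

definition modular_triple :: "'a::lattice \<Rightarrow> 'a \<Rightarrow> 'a \<Rightarrow> bool" where
  "modular_triple p q r \<longleftrightarrow> p \<le> r \<and> (p \<squnion> q) \<sqinter> r = p \<squnion> (q \<sqinter> r)"

end

theory Submission
  imports Defs
begin

text \<open>Since \<open>y\<close> is a complement of \<open>x\<close>, one side of each modular law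
  collapses, so the two triples say exactly \<open>x \<sqinter> e = a\<close> and
  \<open>x \<squnion> f = b\<close>. The other two equations for relative complements follow from
  these by monotonicity, because \<open>a \<le> f \<le> e \<le> b\<close>.\<close>

theorem theorem2:
  fixes a b x y e f :: "'a::bounded_lattice"
  assumes "a \<le> b"
    and "x \<in> {a..b}"
    and "complement_of x y"
    and "e = (a \<squnion> y) \<sqinter> b"
    and "f = a \<squnion> (y \<sqinter> b)"
  shows "f \<le> e \<and>
    ((e \<in> relative_complements a b x \<and> f \<in> relative_complements a b x) \<longleftrightarrow>
     (modular_triple a y x \<and> modular_triple x y b))"
proof -
  have ax: "a \<le> x" and xb: "x \<le> b" and top: "x \<squnion> y = \<top>" and bot: "y \<sqinter> x = \<bottom>"
    using assms(2,3) by (auto simp: complement_of_def inf_commute)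
  have fe: "f \<le> e"
    unfolding assms(4,5) using \<open>a \<le> b\<close> by (simp add: le_infI1 le_supI2)
  have af: "a \<le> f" and eb: "e \<le> b"
    by (simp_all add: assms(4,5))
  have "x \<sqinter> e = (a \<squnion> y) \<sqinter> x"
    unfolding assms(4) using xb by (metis inf.absorb1 inf.commute inf.left_commute)
  \<comment> \<open>The right side \<open>a \<squnion> (y \<sqinter> x)\<close> reduces to
    \<open>a\<close> by \<open>bot\<close>.\<close>
  then have meet: "modular_triple a y x \<longleftrightarrow> x \<sqinter> e = a"
    using ax bot by (simp add: modular_triple_def)
  have "x \<squnion> f = x \<squnion> (y \<sqinter> b)"
    unfolding assms(5) using ax by (metis sup.absorb1 sup.assoc)
  \<comment> \<open>Dually, the left side \<open>(x \<squnion> y) \<sqinter> b\<close> reduces to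
    \<open>b\<close> by \<open>top\<close>.\<close>
  then have join: "modular_triple x y b \<longleftrightarrow> x \<squnion> f = b"
    using xb top by (auto simp: modular_triple_def)
  \<comment> \<open>Squeeze: \<open>a \<le> x \<sqinter> f \<le> x \<sqinter> e\<close>; the next
    claim is dual.\<close>
  have "x \<sqinter> f = a" if "x \<sqinter> e = a"
    using that fe af ax by (metis antisym inf_greatest inf_mono order_refl)
  moreover have "x \<squnion> e = b" if "x \<squnion> f = b"
    using that fe eb xb by (metis antisym sup_least sup_mono order_refl)
  moreover have "e \<in> {a..b}" "f \<in> {a..b}"
    using fe af eb by auto
  ultimately show ?thesis
    using fe meet join by (auto simp: relative_complements_def)
qed

end
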